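(* Let $U$ and $V$ consist of $n$ i.i.d. random points each, sampled independently from probability measures $\mu$ (supply) and $\nu$ (demand) on the network $\mathcal L$, and consider the minimum-distance perfect bipartite matching between $U$ and $V$ with respect to shortest-path distance on the network. When $\mu=\nu$, the fraction of inter-edge matches (matched pairs whose two points lie on different edges, as a fraction of all $n$ matched pairs) converges to zero as $n\to\infty$.
   Context: $(\mathcal V,\mathcal E)$ is an undirected network. Each edge $e\in\mathcal E$ has length $l_e\ge 0$ and end nodes $v_e^-,v_e^+\in\mathcal V$ (an arbitrary orientation from $v_e^-$ to $v_e^+$ is fixed). A location on $e$ is recorded as $(e,x)$, $x\in[0,l_e]$, where $x$ is the distance from $v_e^-$ along $e$. Put $\mathcal L_e(x)=\{(e,y):y\in[0,x]\}$ and $\mathcal L=\bigcup_{e}\mathcal L_e(l_e)$. $\mu,\nu$ are probability measures on a $\sigma$-algebra $\mathcal F$ on $\mathcal L$. The network and $\mu,\nu$ are fixed as $n\to\infty$. The optimal matching is obtained from the equivalent flow problem as follows. Let $S_e(x)=|U\cap\mathcal L_e(x)|-|V\cap\mathcal L_e(x)|$, $\mathbf s=(S_e(l_e))_{e}$, $\Psi_e(c;\xi_e)=\int_0^{l_e}|\xi_e(x)-c|\,dx$, let $\mathbf I^+$ (resp. $\mathbf I^-$) be the $\mathcal V\times\mathcal E$ matrix whose $(v,e)$ entry is $1$ if $v_e^+=v$ (resp. $v_e^-=v$) and $0$ otherwise, and $\mathbf I=\mathbf I^+-\mathbf I^-$. Let $\mathbf c^{\mathrm{int}}$ minimize $\sum_e\Psi_e(c_e;S_e)$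 over $\mathbf c\in\mathbb Z^{|\mathcal E|}$ with $\mathbf I\mathbf c=\mathbf I^+\mathbf s$, and let $f_e(x)=S_e(x)-\mathbf c^{\mathrm{int}}_e$ be the induced net flow on $e$. On each edge the area between $f_e$ and the $x$-axis is sliced into unit-height layers, each upward jump of a layer being paired with the first subsequent downward jump (symmetrically for negative values). Layers starting and ending at points inside $e$ give matches within $e$; the flow $|f_e(0)|$ and $|f_e(l_e)|$ entering or leaving at the ends of $e$ accounts for the points on $e$ matched outside $e$, with path segments concatenated at the nodes. *)

theory Defs
  imports "HOL-Probability.Probability"
begin

section \<open>Networks\<close>

record ('v, 'e) network =
  nodes :: "'v set"
  edges :: "'e set"
  tail :: "'e \<Rightarrow> 'v"
  head :: "'e \<Rightarrow> 'v"
  len :: "'e \<Rightarrow> real"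

text \<open>The edges are undirected: \<^term>\<open>tail G e\<close> and \<^term>\<open>head G e\<close> only record the fixed
  orientation of \<open>e\<close>, and a walk may traverse an edge either way. The last argument is the
  length of the walk.\<close>

inductive walk :: "('v, 'e) network \<Rightarrow> 'v \<Rightarrow> 'v \<Rightarrow> real \<Rightarrow> bool" for G where
  walk_refl: "a \<in> nodes G \<Longrightarrow> walk G a a 0"
| walk_forward: "e \<in> edges G \<Longrightarrow> walk G (head G e) b w \<Longrightarrow> walk G (tail G e) b (len G e + w)"
| walk_backward: "e \<in> edges G \<Longrightarrow> walk G (tail G e) b w \<Longrightarrow> walk G (head G e) b (len G e + w)"

definition is_network :: "('v, 'e) network \<Rightarrow> bool" where
  "is_network G \<longleftrightarrow>
     finite (nodes G) \<and> finite (edges G) \<and>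
     (\<forall>e\<in>edges G. tail G e \<in> nodes G \<and> head G e \<in> nodes G \<and> 0 \<le> len G e) \<and>
     (\<forall>a\<in>nodes G. \<forall>b\<in>nodes G. \<exists>w. walk G a b w)"

type_synonym 'e location = "'e \<times> real"

definition edge_upto :: "'e \<Rightarrow> real \<Rightarrow> 'e location set" where
  "edge_upto e x = {(e, y) | y. 0 \<le> y \<and> y \<le> x}"

definition locations :: "('v, 'e) network \<Rightarrow> 'e location set" where
  "locations G = (\<Union>e\<in>edges G. edge_upto e (len G e))"

definition end_dists :: "('v, 'e) network \<Rightarrow> 'e location \<Rightarrow> ('v \<times> real) set" where
  "end_dists G p = {(tail G (fst p), snd p), (head G (fst p), len G (fst p) - snd p)}"

definition path_lengths :: "('v, 'e) network \<Rightarrow> 'e location \<Rightarrow> 'e location \<Rightarrow> real set" where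
  "path_lengths G p q =
     {r. fst p = fst q \<and> r = \<bar>snd p - snd q\<bar>} \<union>
     {s + w + t | a s b t w. (a, s) \<in> end_dists G p \<and> (b, t) \<in> end_dists G q \<and> walk G a b w}"

definition network_dist :: "('v, 'e) network \<Rightarrow> 'e location \<Rightarrow> 'e location \<Rightarrow> real" where
  "network_dist G p q = Inf (path_lengths G p q)"


section \<open>Minimum-distance perfect matchings\<close>

text \<open>Supply points are \<open>u 0, \<dots>, u (n - 1)\<close> and demand points \<open>v 0, \<dots>, v (n - 1)\<close>, so that
  coinciding points are counted with multiplicity. A perfect matching \<open>\<sigma>\<close> pairs \<open>u i\<close> with
  \<open>v (\<sigma> i)\<close>.\<close>

definition perfect_matching :: "nat \<Rightarrow> (nat \<Rightarrow> nat) \<Rightarrow> bool" where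
  "perfect_matching n \<sigma> \<longleftrightarrow> bij_betw \<sigma> {..<n} {..<n}"

definition min_distance_matching ::
  "('v, 'e) network \<Rightarrow> nat \<Rightarrow> (nat \<Rightarrow> 'e location) \<Rightarrow> (nat \<Rightarrow> 'e location) \<Rightarrow> (nat \<Rightarrow> nat) \<Rightarrow> bool" where
  "min_distance_matching G n u v \<sigma> \<longleftrightarrow>
     perfect_matching n \<sigma> \<and>
     (\<forall>\<tau>. perfect_matching n \<tau> \<longrightarrow>
        (\<Sum>i<n. network_dist G (u i) (v (\<sigma> i))) \<le> (\<Sum>i<n. network_dist G (u i) (v (\<tau> i))))"

definition inter_edge_fraction ::
  "nat \<Rightarrow> (nat \<Rightarrow> 'e location) \<Rightarrow> (nat \<Rightarrow> 'e location) \<Rightarrow> (nat \<Rightarrow> nat) \<Rightarrow> real" where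
  "inter_edge_fraction n u v \<sigma> = real (card {i. i < n \<and> fst (u i) \<noteq> fst (v (\<sigma> i))}) / real n"


section \<open>The equivalent flow problem\<close>

definition inc_plus :: "('v, 'e) network \<Rightarrow> 'v \<Rightarrow> 'e \<Rightarrow> int" where
  "inc_plus G a e = (if head G e = a then 1 else 0)"

definition inc_minus :: "('v, 'e) network \<Rightarrow> 'v \<Rightarrow> 'e \<Rightarrow> int" where
  "inc_minus G a e = (if tail G e = a then 1 else 0)"

definition incidence :: "('v, 'e) network \<Rightarrow> 'v \<Rightarrow> 'e \<Rightarrow> int" where
  "incidence G a e = inc_plus G a e - inc_minus G a e"

definition Psi :: "real \<Rightarrow> real \<Rightarrow> (real \<Rightarrow> real) \<Rightarrow> real" where
  "Psi l c \<xi> = integral {0..l} (\<lambda>x. \<bar>\<xi> x - c\<bar>)"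

text \<open>\<open>Jump e x m\<close> is a jump of layer \<open>m\<close> at the location \<open>(e, x)\<close>; \<open>AtTail e m\<close> and
  \<open>AtHead e m\<close> are the places where layer \<open>m\<close> meets the tail and the head of \<open>e\<close>.\<close>

datatype 'e layer_end = Jump 'e real int | AtTail 'e int | AtHead 'e int

fun end_node :: "('v, 'e) network \<Rightarrow> 'e layer_end \<Rightarrow> 'v" where
  "end_node G (AtTail e m) = tail G e"
| "end_node G (AtHead e m) = head G e"
| "end_node G (Jump e x m) = undefined"

context
  fixes G :: "('v, 'e) network" and n :: nat and u v :: "nat \<Rightarrow> 'e location"
begin

definition imbalance :: "'e \<Rightarrow> real \<Rightarrow> int" where
  "imbalance e x =
     int (card {i. i < n \<and> u i \<in> edge_upto e x}) - int (card {j. j < n \<and> v j \<in> edge_upto e x})"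

text \<open>The left limit of \<^term>\<open>imbalance e\<close>; at \<open>0\<close> it is \<open>0\<close>, so that points located at the
  tail of \<open>e\<close> count as jumps inside \<open>e\<close>.\<close>

definition imbalance_before :: "'e \<Rightarrow> real \<Rightarrow> int" where
  "imbalance_before e x =
     int (card {i. i < n \<and> (\<exists>y<x. u i \<in> edge_upto e y)})
     - int (card {j. j < n \<and> (\<exists>y<x. v j \<in> edge_upto e y)})"

definition feasible_flow :: "('e \<Rightarrow> int) \<Rightarrow> bool" where
  "feasible_flow c \<longleftrightarrow>
     (\<forall>a\<in>nodes G. (\<Sum>e\<in>edges G. incidence G a e * c e)
                 = (\<Sum>e\<in>edges G. inc_plus G a e * imbalance e (len G e)))"

definition flow_cost :: "('e \<Rightarrow> int) \<Rightarrow> real" where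
  "flow_cost c = (\<Sum>e\<in>edges G. Psi (len G e) (real_of_int (c e)) (\<lambda>x. real_of_int (imbalance e x)))"

definition optimal_flow :: "('e \<Rightarrow> int) \<Rightarrow> bool" where
  "optimal_flow c \<longleftrightarrow> feasible_flow c \<and> (\<forall>c'. feasible_flow c' \<longrightarrow> flow_cost c \<le> flow_cost c')"

context
  fixes c :: "'e \<Rightarrow> int"
begin

definition net_flow :: "'e \<Rightarrow> real \<Rightarrow> int" where
  "net_flow e x = imbalance e x - c e"

definition net_flow_before :: "'e \<Rightarrow> real \<Rightarrow> int" where
  "net_flow_before e x = imbalance_before e x - c e"

text \<open>Layer \<open>m\<close> is the horizontal strip between the heights \<open>m\<close> and \<open>m + 1\<close>. The area between
  \<^term>\<open>net_flow e\<close> and the axis meets it where \<open>net_flow e x > m\<close> if \<open>m \<ge> 0\<close>, and where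
  \<open>net_flow e x \<le> m\<close> if \<open>m < 0\<close>. The net flow jumps up at supply points and down at demand
  points.\<close>

definition up_jump :: "'e \<Rightarrow> real \<Rightarrow> int \<Rightarrow> bool" where
  "up_jump e x m \<longleftrightarrow>
     e \<in> edges G \<and> 0 \<le> x \<and> x \<le> len G e \<and> net_flow_before e x \<le> m \<and> m < net_flow e x"

definition down_jump :: "'e \<Rightarrow> real \<Rightarrow> int \<Rightarrow> bool" where
  "down_jump e x m \<longleftrightarrow>
     e \<in> edges G \<and> 0 \<le> x \<and> x \<le> len G e \<and> net_flow e x \<le> m \<and> m < net_flow_before e x"

definition supply_ends :: "'e layer_end set" where
  "supply_ends = {Jump e x m | e x m. up_jump e x m}"

definition demand_ends :: "'e layer_end set" where
  "demand_ends = {Jump e x m | e x m. down_jump e x m}"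

text \<open>\<open>layer_segment p q\<close>: a unit of flow runs along one layer of one edge from \<open>p\<close> to \<open>q\<close>. It runs
  towards the head of the edge in the layers \<open>m \<ge> 0\<close> and towards the tail in the layers \<open>m < 0\<close>.\<close>

inductive layer_segment :: "'e layer_end \<Rightarrow> 'e layer_end \<Rightarrow> bool" where
  pos_inner: "\<lbrakk>0 \<le> m; up_jump e x m; down_jump e y m; x < y; \<forall>z. x < z \<and> z < y \<longrightarrow> \<not> down_jump e z m\<rbrakk>
    \<Longrightarrow> layer_segment (Jump e x m) (Jump e y m)"
| pos_leave: "\<lbrakk>0 \<le> m; up_jump e x m; \<forall>z>x. \<not> down_jump e z m\<rbrakk>
    \<Longrightarrow> layer_segment (Jump e x m) (AtHead e m)"
| pos_enter: "\<lbrakk>0 \<le> m; m < - c e; down_jump e y m; \<forall>z<y. \<not> down_jump e z m\<rbrakk>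
    \<Longrightarrow> layer_segment (AtTail e m) (Jump e y m)"
| pos_through: "\<lbrakk>e \<in> edges G; 0 \<le> m; m < - c e; \<forall>z. \<not> down_jump e z m\<rbrakk>
    \<Longrightarrow> layer_segment (AtTail e m) (AtHead e m)"
| neg_inner: "\<lbrakk>m < 0; down_jump e y m; up_jump e x m; y < x; \<forall>z. y < z \<and> z < x \<longrightarrow> \<not> up_jump e z m\<rbrakk>
    \<Longrightarrow> layer_segment (Jump e x m) (Jump e y m)"
| neg_leave: "\<lbrakk>m < 0; - c e \<le> m; up_jump e x m; \<forall>z<x. \<not> up_jump e z m\<rbrakk>
    \<Longrightarrow> layer_segment (Jump e x m) (AtTail e m)"
| neg_enter: "\<lbrakk>m < 0; down_jump e y m; \<forall>z>y. \<not> up_jump e z m\<rbrakk>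
    \<Longrightarrow> layer_segment (AtHead e m) (Jump e y m)"
| neg_through: "\<lbrakk>e \<in> edges G; m < 0; - c e \<le> m; \<forall>z. \<not> up_jump e z m\<rbrakk>
    \<Longrightarrow> layer_segment (AtHead e m) (AtTail e m)"

text \<open>Flow leaving the edges into nodes, and flow entering the edges from nodes. The flow on \<open>e\<close> is
  \<open>- c e\<close> just before the first point and \<^term>\<open>net_flow e (len G e)\<close> at the head.\<close>

definition exits :: "'e layer_end set" where
  "exits = {AtHead e m | e m. e \<in> edges G \<and> 0 \<le> m \<and> m < net_flow e (len G e)}
         \<union> {AtTail e m | e m. e \<in> edges G \<and> - c e \<le> m \<and> m < 0}"

definition entries :: "'e layer_end set" where
  "entries = {AtTail e m | e m. e \<in> edges G \<and> 0 \<le> m \<and> m < - c e}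
           \<union> {AtHead e m | e m. e \<in> edges G \<and> net_flow e (len G e) \<le> m \<and> m < 0}"

definition concatenation :: "('e layer_end \<Rightarrow> 'e layer_end) \<Rightarrow> bool" where
  "concatenation \<kappa> \<longleftrightarrow> bij_betw \<kappa> exits entries \<and> (\<forall>p\<in>exits. end_node G (\<kappa> p) = end_node G p)"

definition flow_path :: "('e layer_end \<Rightarrow> 'e layer_end) \<Rightarrow> 'e layer_end \<Rightarrow> 'e layer_end \<Rightarrow> bool" where
  "flow_path \<kappa> = (\<lambda>p q. layer_segment p q \<or> p \<in> exits \<and> q = \<kappa> p)\<^sup>*\<^sup>*"

definition labelling :: "(nat \<Rightarrow> 'e location) \<Rightarrow> 'e layer_end set \<Rightarrow> ('e layer_end \<Rightarrow> nat) \<Rightarrow> bool" where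
  "labelling w J \<alpha> \<longleftrightarrow>
     inj_on \<alpha> J \<and> (\<forall>e x m. Jump e x m \<in> J \<longrightarrow> \<alpha> (Jump e x m) < n \<and> w (\<alpha> (Jump e x m)) = (e, x))"

text \<open>Every up-jump is made by its own supply point and every down-jump by its own demand point.
  A jump is paired with the other end of its flow path. Supply and demand points at the same
  location that cancel in \<^term>\<open>imbalance\<close> make no jump, and are matched with each other; this is
  the last clause, which is vacuous when all points are at distinct locations.\<close>

definition matching_of_flow :: "(nat \<Rightarrow> nat) \<Rightarrow> bool" where
  "matching_of_flow \<sigma> \<longleftrightarrow> perfect_matching n \<sigma> \<and>
     (\<exists>\<kappa> \<alpha> \<beta>. concatenation \<kappa> \<and> labelling u supply_ends \<alpha> \<and> labelling v demand_ends \<beta> \<and>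
        (\<forall>p\<in>supply_ends. \<exists>q\<in>demand_ends. flow_path \<kappa> p q \<and> \<sigma> (\<alpha> p) = \<beta> q) \<and>
        (\<forall>i<n. i \<notin> \<alpha> ` supply_ends \<longrightarrow> v (\<sigma> i) = u i))"

end

text \<open>Minimum-distance matchings need not be unique. The one considered is obtained from an optimal
  integer flow.\<close>

definition optimal_matching :: "(nat \<Rightarrow> nat) \<Rightarrow> bool" where
  "optimal_matching \<sigma> \<longleftrightarrow>
     min_distance_matching G n u v \<sigma> \<and> (\<exists>c. optimal_flow c \<and> matching_of_flow c \<sigma>)"

end


section \<open>Random points\<close>

text \<open>\<open>\<F> = sets \<mu> = sets \<nu>\<close> is a \<open>\<sigma>\<close>-algebra on the locations for which the counts
  \<^const>\<open>imbalance\<close> are random variables.\<close>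

definition network_measure :: "('v, 'e) network \<Rightarrow> 'e location measure \<Rightarrow> bool" where
  "network_measure G \<mu> \<longleftrightarrow>
     prob_space \<mu> \<and> space \<mu> = locations G \<and>
     (\<forall>e\<in>edges G. \<forall>x\<in>{0..len G e}. edge_upto e x \<in> sets \<mu>)"

text \<open>The \<open>2 n\<close> points are jointly independent.\<close>

definition random_points ::
  "'w measure \<Rightarrow> 'e location measure \<Rightarrow> 'e location measure \<Rightarrow> nat \<Rightarrow>
   (nat \<Rightarrow> 'w \<Rightarrow> 'e location) \<Rightarrow> (nat \<Rightarrow> 'w \<Rightarrow> 'e location) \<Rightarrow> bool" where
  "random_points \<Omega> \<mu> \<nu> n U V \<longleftrightarrow>
     prob_space.indep_vars \<Omega> (case_sum (\<lambda>_. \<mu>) (\<lambda>_. \<nu>)) (case_sum U V) ({..<n} <+> {..<n}) \<and>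
     (\<forall>i<n. distr \<Omega> \<mu> (U i) = \<mu>) \<and> (\<forall>j<n. distr \<Omega> \<nu> (V j) = \<nu>)"

end

theory Submission
  imports Defs
begin

text \<open>Since \<open>\<mu> = \<nu>\<close>, the imbalance on every edge is the difference of two empirical distribution
  functions of the same law, so Hoeffding's inequality, the Borel--Cantelli lemma and a
  Glivenko--Cantelli argument give \<open>max \<bar>imbalance\<bar> = o(n)\<close> almost surely. Some feasible integer flow is
  of the order of this maximum, hence by optimality so is \<open>c e\<close> on every edge of positive length. A supply
  point matched to another edge sits at a jump whose layer reaches an end of its edge; each layer has at
  most one such jump, and on each edge the number of these layers is again of the order of the maximal
  imbalance. On edges of length \<open>0\<close> the jumps themselves are counted.\<close>

section \<open>Uniform convergence of empirical distributions\<close>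

text \<open>The samples for different \<open>n\<close> need not be related. Hoeffding's inequality
  bounds the probability of a deviation \<open>\<epsilon> * real n\<close> geometrically in
  \<open>n\<close>, and the first Borel-Cantelli lemma asks only for summability.\<close>

lemma (in prob_space) AE_empirical_frequency:
  fixes X :: "nat \<Rightarrow> 'i \<Rightarrow> 'a \<Rightarrow> 'b" and I :: "nat \<Rightarrow> 'i set"
  assumes fin: "\<And>n. finite (I n)" and card: "\<And>n. card (I n) = n"
    and indep: "\<And>n. indep_vars (\<lambda>_. N) (X n) (I n)"
    and distr: "\<And>n i. i \<in> I n \<Longrightarrow> distr M N (X n i) = N"
    and A: "A \<in> sets N" and \<epsilon>: "\<epsilon> > 0"
  shows "AE \<omega> in M. \<forall>\<^sub>F n in sequentially.
           \<bar>(\<Sum>i\<in>I n. indicator A (X n i \<omega>)) - real n * measure N A\<bar> \<le> \<epsilon> * real n"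
proof -
  define p where "p = measure N A"
  define S where "S n \<omega> = (\<Sum>i\<in>I n. indicator A (X n i \<omega>) :: real)" for n \<omega>
  define B where "B n = {\<omega> \<in> space M. \<bar>S n \<omega> - real n * p\<bar> \<ge> \<epsilon> * real n}" for n
  have rv: "X n i \<in> measurable M N" if "i \<in> I n" for n i
    using indep[of n] that by (auto simp: indep_vars_def)
  have rvA: "(\<lambda>\<omega>. indicator A (X n i \<omega>) :: real) \<in> borel_measurable M" if "i \<in> I n" for n i
    using rv[OF that] A by measurable
  have meas_S [measurable]: "S n \<in> borel_measurable M" for n
    unfolding S_def using rvA by (intro borel_measurable_sum) auto
  have B_sets [measurable]: "B n \<in> sets M" for n
    unfolding B_def by measurable
  have expect: "expectation (\<lambda>\<omega>. indicator A (X n i \<omega>) :: real) = p" if i: "i \<in> I n" for n i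
  proof -
    have "p = measure (distr M N (X n i)) A"
      using distr[OF i] by (simp add: p_def)
    also have "\<dots> = prob (X n i -` A \<inter> space M)"
      using rv[OF i] A by (rule measure_distr)
    also have "\<dots> = expectation (indicator (X n i -` A \<inter> space M) :: 'a \<Rightarrow> real)"
      by simp
    also have "\<dots> = expectation (\<lambda>\<omega>. indicator A (X n i \<omega>) :: real)"
      by (intro Bochner_Integration.integral_cong) (auto simp: indicator_def)
    finally show ?thesis ..
  qed
  have bound: "prob (B n) \<le> 2 * exp (- 2 * \<epsilon>\<^sup>2) ^ n" for n
  proof (cases "n = 0")
    case True
    show ?thesis by (rule order_trans[OF prob_le_1]) (simp add: True)
  next
    case False
    interpret H: Hoeffding_ineq M "I n" "\<lambda>i \<omega>. indicator A (X n i \<omega>) :: real" "\<lambda>_. 0" "\<lambda>_. 1" "real n * p"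
    proof unfold_locales
      show "indep_vars (\<lambda>_. borel) (\<lambda>i \<omega>. indicator A (X n i \<omega>) :: real) (I n)"
        by (rule indep_vars_compose2[OF indep[of n]]) (use A in measurable)
      show "real n * p \<equiv> \<Sum>i\<in>I n. expectation (\<lambda>\<omega>. indicator A (X n i \<omega>) :: real)"
        by (simp add: expect card)
    qed (auto simp: fin indicator_def)
    have "prob (B n) \<le> 2 * exp (- 2 * (\<epsilon> * real n)\<^sup>2 / (\<Sum>i\<in>I n. (1 - 0)\<^sup>2))"
      unfolding B_def S_def using H.Hoeffding_ineq_abs_ge[of "\<epsilon> * real n"] \<epsilon> False
      by (simp add: card)
    also have "- 2 * (\<epsilon> * real n)\<^sup>2 / (\<Sum>i\<in>I n. (1 - 0)\<^sup>2) = real n * (- 2 * \<epsilon>\<^sup>2)"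
      using False by (simp add: card power2_eq_square)
    finally show ?thesis
      by (simp add: exp_of_nat_mult [symmetric])
  qed
  have "summable (\<lambda>n. 2 * exp (- 2 * \<epsilon>\<^sup>2) ^ n)"
    using \<epsilon> by (intro summable_mult summable_geometric) auto
  then have "summable (\<lambda>n. prob (B n))"
    by (rule summable_comparison_test[rotated]) (use bound in auto)
  then have "AE \<omega> in M. \<forall>\<^sub>F n in sequentially. \<omega> \<in> space M - B n"
    by (intro borel_cantelli_AE1) (auto simp: less_top[symmetric])
  then show ?thesis
  proof (rule AE_mp, intro AE_I2 impI)
    fix \<omega> assume "\<omega> \<in> space M" and ev: "\<forall>\<^sub>F n in sequentially. \<omega> \<in> space M - B n"
    from ev show "\<forall>\<^sub>F n in sequentially.
        \<bar>(\<Sum>i\<in>I n. indicator A (X n i \<omega>)) - real n * measure N A\<bar> \<le> \<epsilon> * real n"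
      by eventually_elim (auto simp: B_def S_def p_def)
  qed
qed

text \<open>Both counts of \<open>B\<close> lie between \<open>n * p - (\<epsilon> / 4) * n\<close>
  and \<open>n * q + (\<epsilon> / 4) * n\<close>, which differ by at most
  \<open>\<epsilon> * n\<close>.\<close>

lemma two_sample_squeeze:
  fixes x y :: "'i \<Rightarrow> 'b" and p q :: real
  assumes AB: "A \<subseteq> B" and BC: "B \<subseteq> C" and pq: "q - p \<le> \<epsilon> / 2" and n: "n \<ge> 0"
    and xA: "\<bar>(\<Sum>i\<in>I. indicator A (x i)) - n * p\<bar> \<le> (\<epsilon> / 4) * n"
    and yA: "\<bar>(\<Sum>i\<in>J. indicator A (y i)) - n * p\<bar> \<le> (\<epsilon> / 4) * n"
    and xC: "\<bar>(\<Sum>i\<in>I. indicator C (x i)) - n * q\<bar> \<le> (\<epsilon> / 4) * n"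
    and yC: "\<bar>(\<Sum>i\<in>J. indicator C (y i)) - n * q\<bar> \<le> (\<epsilon> / 4) * n"
  shows "\<bar>(\<Sum>i\<in>I. indicator B (x i)) - (\<Sum>i\<in>J. indicator B (y i) :: real)\<bar> \<le> \<epsilon> * n"
proof -
  have mono: "(\<Sum>i\<in>K. indicator D (z i) :: real) \<le> (\<Sum>i\<in>K. indicator E (z i))"
    if "D \<subseteq> E" for D E :: "'b set" and K and z :: "'i \<Rightarrow> 'b"
    using that by (intro sum_mono) (auto simp: indicator_def)
  have "n * q - n * p \<le> (\<epsilon> / 2) * n"
    using mult_right_mono[OF pq n] by (simp add: algebra_simps)
  moreover have "(\<epsilon> / 4) * n + (\<epsilon> / 4) * n + (\<epsilon> / 2) * n = \<epsilon> * n" by (simp add: algebra_simps)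
  ultimately show ?thesis
    using xA yA xC yC mono[OF AB, of x I] mono[OF AB, of y J] mono[OF BC, of x I] mono[OF BC, of y J]
    by linarith
qed

text \<open>The Bolzano induction needs no quantile grid: near every \<open>x\<close> the laws of large numbers at
  \<open>{..a}\<close>, \<open>{..<x}\<close>, \<open>{..x}\<close> and \<open>{..b}\<close> control all of \<open>[a, b]\<close> by monotonicity.\<close>

lemma (in prob_space) AE_two_sample_Glivenko_Cantelli:
  fixes X Y :: "nat \<Rightarrow> 'i \<Rightarrow> 'a \<Rightarrow> real" and I J :: "nat \<Rightarrow> 'i set"
  assumes "\<And>n. finite (I n)" and "\<And>n. card (I n) = n"
    and "\<And>n. indep_vars (\<lambda>_. N) (X n) (I n)"
    and "\<And>n i. i \<in> I n \<Longrightarrow> distr M N (X n i) = N"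
    and "\<And>n. finite (J n)" and "\<And>n. card (J n) = n"
    and "\<And>n. indep_vars (\<lambda>_. N) (Y n) (J n)"
    and "\<And>n i. i \<in> J n \<Longrightarrow> distr M N (Y n i) = N"
    and N: "real_distribution N" and \<epsilon>: "\<epsilon> > 0" and ab: "a \<le> b"
  shows "AE \<omega> in M. \<forall>\<^sub>F n in sequentially. \<forall>t\<in>{a..b}.
           \<bar>(\<Sum>i\<in>I n. indicator {..t} (X n i \<omega>)) - (\<Sum>i\<in>J n. indicator {..t} (Y n i \<omega>))\<bar>
             \<le> \<epsilon> * real n"
  using ab
proof (induction a b rule: Bolzano)
  case (trans a b c)
  from trans(1,2) show ?case
  proof eventually_elim
    case (elim \<omega>)
    then show ?case
    proof eventually_elim
      case (elim n)
      then show ?case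
        using trans(3,4) by (metis atLeastAtMost_iff linear)
    qed
  qed
next
  case (local x)
  interpret N: real_distribution N by (rule N)
  \<comment> \<open>The law may have an atom at \<open>x\<close>. So \<open>{..<x}\<close> is
    approximated from the left and \<open>{..x}\<close> from the right, and no \<open>{..t}\<close>
    is squeezed across the atom.\<close>
  define F where "F = measure N"
  have "\<forall>\<^sub>F y in at_left x. F {..y} > F {..<x} - \<epsilon> / 2"
    using N.cdf_at_left[of x] \<epsilon> unfolding cdf_def F_def by (intro order_tendstoD(1)) auto
  then obtain d1 where d1: "d1 < x" "\<And>y. d1 < y \<Longrightarrow> y < x \<Longrightarrow> F {..y} > F {..<x} - \<epsilon> / 2"
    by (auto simp: eventually_at_left[of "x - 1" x])
  have "\<forall>\<^sub>F y in at_right x. F {..y} < F {..x} + \<epsilon> / 2"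
    using N.cdf_is_right_cont[of x] \<epsilon> unfolding cdf_def F_def continuous_within
    by (intro order_tendstoD(2)) auto
  then obtain d2 where d2: "d2 > x" "\<And>y. x < y \<Longrightarrow> y < d2 \<Longrightarrow> F {..y} < F {..x} + \<epsilon> / 2"
    by (auto simp: eventually_at_right[of x "x + 1"])
  show ?case
  \<comment> \<open>Intervals around \<open>x\<close> shorter than this radius start after
    \<open>d1\<close> and end before \<open>d2\<close>.\<close>
  proof (intro exI[of _ "min (x - d1) (d2 - x)"] conjI allI impI)
    show "min (x - d1) (d2 - x) > 0" using d1 d2 by auto
  next
    fix a b assume ab: "a \<le> x \<and> x \<le> b \<and> b - a < min (x - d1) (d2 - x)"
    have left: "F {..<x} - F {..a} \<le> \<epsilon> / 2" if "a < x"
      using d1(2)[of a] ab that by auto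
    have right: "F {..b} - F {..x} \<le> \<epsilon> / 2"
      using d2(2)[of b] ab \<epsilon> by (cases "x = b") auto
    have freqX: "AE \<omega> in M. \<forall>\<^sub>F n in sequentially.
        \<bar>(\<Sum>i\<in>I n. indicator A (X n i \<omega>)) - real n * F A\<bar> \<le> \<epsilon> / 4 * real n" if "A \<in> sets borel" for A
      unfolding F_def using that \<epsilon> assms by (intro AE_empirical_frequency) auto
    have freqY: "AE \<omega> in M. \<forall>\<^sub>F n in sequentially.
        \<bar>(\<Sum>i\<in>J n. indicator A (Y n i \<omega>)) - real n * F A\<bar> \<le> \<epsilon> / 4 * real n" if "A \<in> sets borel" for A
      unfolding F_def using that \<epsilon> assms by (intro AE_empirical_frequency) auto
    have sets: "{..a} \<in> sets borel" "{..<x} \<in> sets borel" "{..x} \<in> sets borel" "{..b} \<in> sets borel"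
      by auto
    show "AE \<omega> in M. \<forall>\<^sub>F n in sequentially. \<forall>t\<in>{a..b}.
           \<bar>(\<Sum>i\<in>I n. indicator {..t} (X n i \<omega>)) - (\<Sum>i\<in>J n. indicator {..t} (Y n i \<omega>))\<bar>
             \<le> \<epsilon> * real n"
      using sets[THEN freqX] sets[THEN freqY]
    proof eventually_elim
      case (elim \<omega>)
      then show ?case
      proof eventually_elim
        case (elim n)
        show ?case
        proof
          fix t assume t: "t \<in> {a..b}"
          show "\<bar>(\<Sum>i\<in>I n. indicator {..t} (X n i \<omega>)) - (\<Sum>i\<in>J n. indicator {..t} (Y n i \<omega>))\<bar>
             \<le> \<epsilon> * real n"
          proof (cases "t < x")
            case True
            with t have "{..a} \<subseteq> {..t}" "{..t} \<subseteq> {..<x}" by auto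
            then show ?thesis
              by (rule two_sample_squeeze[where p = "F {..a}" and q = "F {..<x}"])
                (use left True t in simp, simp, fact+)
          next
            case False
            with t have "{..x} \<subseteq> {..t}" "{..t} \<subseteq> {..b}" by auto
            then show ?thesis
              by (rule two_sample_squeeze[where p = "F {..x}" and q = "F {..b}"])
                (fact right, simp, fact+)
          qed
        qed
      qed
    qed
  qed
qed

section \<open>Size of optimal flows\<close>

text \<open>\<open>z\<close> counts the forward passages of the walk through each edge minus the
  backward ones. Along the walk the boundary terms telescope, which leaves a unit flow from
  \<open>a\<close> to \<open>b\<close>.\<close>

lemma walk_potential:
  assumes "walk G a b w" and fin: "finite (edges G)"
  shows "\<exists>z. \<forall>x. (\<Sum>e\<in>edges G. incidence G x e * z e) = of_bool (x = b) - of_bool (x = a)"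
  using assms(1)
proof induction
  case (walk_refl a)
  show ?case by (intro exI[of _ "\<lambda>_. 0"]) simp
next
  case (walk_forward e b w)
  then obtain z where z: "(\<Sum>e\<in>edges G. incidence G x e * z e) = of_bool (x = b) - of_bool (x = head G e)" for x
    by blast
  have "(\<Sum>f\<in>edges G. incidence G x f * (z f + of_bool (f = e))) = of_bool (x = b) - of_bool (x = tail G e)" for x
    using fin walk_forward.hyps
    by (simp add: distrib_left sum.distrib z of_bool_def if_distrib[of "\<lambda>t. _ * t"] sum.delta' cong: if_cong)
       (auto simp: incidence_def inc_plus_def inc_minus_def)
  then show ?case by (intro exI allI)
next
  case (walk_backward e b w)
  then obtain z where z: "(\<Sum>e\<in>edges G. incidence G x e * z e) = of_bool (x = b) - of_bool (x = tail G e)" for x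
    by blast
  have "(\<Sum>f\<in>edges G. incidence G x f * (z f - of_bool (f = e))) = of_bool (x = b) - of_bool (x = head G e)" for x
    using fin walk_backward.hyps
    by (simp add: right_diff_distrib sum_subtractf z of_bool_def if_distrib[of "\<lambda>t. _ * t"] sum.delta' cong: if_cong)
       (auto simp: incidence_def inc_plus_def inc_minus_def)
  then show ?case by (intro exI allI)
qed

text \<open>The supply surplus of every edge is routed along a fixed walk from its head to a common root.\<close>

lemma bounded_flow_exists:
  assumes G: "is_network G"
  shows "\<exists>K\<ge>0. \<forall>s M. (\<Sum>e\<in>edges G. s e) = 0 \<longrightarrow> (\<forall>e\<in>edges G. \<bar>s e\<bar> \<le> M) \<longrightarrow>
           (\<exists>c. (\<forall>a. (\<Sum>e\<in>edges G. incidence G a e * c e) = (\<Sum>e\<in>edges G. inc_plus G a e * s e)) \<and>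
                (\<forall>e\<in>edges G. \<bar>c e\<bar> \<le> K * (M :: int)))"
proof (cases "edges G = {}")
  case True
  then show ?thesis by auto
next
  case False
  then obtain e0 where e0: "e0 \<in> edges G" by blast
  have fin: "finite (edges G)" using G by (simp add: is_network_def)
  define r where "r = head G e0"
  have "\<exists>z. \<forall>x. (\<Sum>f\<in>edges G. incidence G x f * z f) = of_bool (x = r) - of_bool (x = head G e)"
    if e: "e \<in> edges G" for e
  proof -
    have "\<exists>w. walk G (head G e) r w" using G e e0 by (simp add: is_network_def r_def)
    then show ?thesis using walk_potential fin by metis
  qed
  then obtain z where z: "\<And>e x. e \<in> edges G \<Longrightarrow>
      (\<Sum>f\<in>edges G. incidence G x f * z e f) = of_bool (x = r) - of_bool (x = head G e)"
    by metis
  \<comment> \<open>The total size of all routing flows, a crude bound fixed before \<open>s\<close>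
    and \<open>M\<close> are given.\<close>
  define K where "K = (\<Sum>f\<in>edges G. \<Sum>e\<in>edges G. \<bar>z e f\<bar>)"
  show ?thesis
  proof (intro exI[of _ K] conjI allI impI)
    show "K \<ge> 0" unfolding K_def by (intro sum_nonneg) auto
  next
    fix s :: "'b \<Rightarrow> int" and M :: int
    assume s0: "(\<Sum>e\<in>edges G. s e) = 0" and sM: "\<forall>e\<in>edges G. \<bar>s e\<bar> \<le> M"
    have M: "M \<ge> 0" using sM e0 by fastforce
    \<comment> \<open>The unit flow \<open>z e\<close> contributes \<open>-1\<close> at the head of
      \<open>e\<close>, whence the minus sign, and \<open>1\<close> at the root. The root
      contributions cancel because the \<open>s e\<close> sum to \<open>0\<close>.\<close>
    define c where "c f = - (\<Sum>e\<in>edges G. s e * z e f)" for f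
    have "(\<Sum>f\<in>edges G. incidence G a f * c f) = (\<Sum>e\<in>edges G. inc_plus G a e * s e)" for a
    proof -
      have "(\<Sum>f\<in>edges G. incidence G a f * c f)
          = - (\<Sum>f\<in>edges G. \<Sum>e\<in>edges G. s e * (incidence G a f * z e f))"
        by (simp add: c_def sum_negf sum_distrib_left mult_ac)
      also have "\<dots> = - (\<Sum>e\<in>edges G. s e * (\<Sum>f\<in>edges G. incidence G a f * z e f))"
        by (subst sum.swap) (simp add: sum_distrib_left)
      also have "\<dots> = - (\<Sum>e\<in>edges G. s e * of_bool (a = r) - inc_plus G a e * s e)"
        by (simp add: z inc_plus_def right_diff_distrib of_bool_def eq_commute[of a]
              if_distrib[of "\<lambda>t. t * _"] if_distrib[of "\<lambda>t. _ * t"] cong: if_cong)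
      also have "\<dots> = (\<Sum>e\<in>edges G. inc_plus G a e * s e)"
        by (simp add: sum_subtractf s0 flip: sum_distrib_right)
      finally show ?thesis .
    qed
    moreover have "\<bar>c f\<bar> \<le> K * M" if f: "f \<in> edges G" for f
    proof -
      have "\<bar>c f\<bar> \<le> (\<Sum>e\<in>edges G. \<bar>s e * z e f\<bar>)"
        by (simp add: c_def sum_abs)
      also have "\<dots> \<le> (\<Sum>e\<in>edges G. \<bar>z e f\<bar> * M)"
        using sM by (intro sum_mono) (simp add: abs_mult mult.commute mult_right_mono)
      also have "\<dots> = (\<Sum>e\<in>edges G. \<bar>z e f\<bar>) * M"
        by (simp add: sum_distrib_right)
      also have "\<dots> \<le> K * M" unfolding K_def
        using fin f M by (intro mult_right_mono member_le_sum) (auto intro: sum_nonneg)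
      finally show ?thesis .
    qed
    ultimately show "\<exists>c. (\<forall>a. (\<Sum>e\<in>edges G. incidence G a e * c e) = (\<Sum>e\<in>edges G. inc_plus G a e * s e)) \<and>
                (\<forall>e\<in>edges G. \<bar>c e\<bar> \<le> K * M)"
      by blast
  qed
qed

section \<open>The imbalance of an edge and its cost\<close>

lemma imbalance_eq_sum:
  "imbalance n u v e x = (\<Sum>i<n. of_bool (u i \<in> edge_upto e x)) - (\<Sum>j<n. of_bool (v j \<in> edge_upto e x))"
  by (simp add: imbalance_def of_bool_def sum.If_cases lessThan_def Collect_conj_eq)

text \<open>A location carries the name of its edge, so even at a node it is counted on exactly one
  edge; supply and demand both add up to \<open>n\<close>. This balance makes the flow equations
  solvable.\<close>

lemma sum_imbalance_eq_0:
  assumes G: "is_network G"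
    and uv: "\<And>i. i < n \<Longrightarrow> u i \<in> locations G" "\<And>j. j < n \<Longrightarrow> v j \<in> locations G"
  shows "(\<Sum>e\<in>edges G. imbalance n u v e (len G e)) = 0"
proof -
  have fin: "finite (edges G)" using G by (simp add: is_network_def)
  have one: "(\<Sum>e\<in>edges G. of_bool (p \<in> edge_upto e (len G e))) = (1 :: int)" if p: "p \<in> locations G" for p
  proof -
    have "p \<in> edge_upto e (len G e) \<longleftrightarrow> e = fst p" if "e \<in> edges G" for e
      using p that by (auto simp: locations_def edge_upto_def)
    then have "(\<Sum>e\<in>edges G. of_bool (p \<in> edge_upto e (len G e))) = (\<Sum>e\<in>edges G. of_bool (e = fst p) :: int)"
      by simp
    also have "\<dots> = 1"
      using p fin by (auto simp: of_bool_def locations_def edge_upto_def)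
    finally show ?thesis .
  qed
  have "(\<Sum>e\<in>edges G. \<Sum>i<n. of_bool (w i \<in> edge_upto e (len G e))) = int n"
    if "\<And>i. i < n \<Longrightarrow> w i \<in> locations G" for w
    by (subst sum.swap) (simp add: one that)
  then show ?thesis using uv
    by (simp add: imbalance_eq_sum sum_subtractf)
qed

text \<open>The integrand deviates from \<open>\<bar>c\<bar>\<close> by at most \<open>M\<close>.
  The lower bound is for the optimal flow, the upper one for the flow it is compared with.\<close>

lemma Psi_imbalance_bounds:
  fixes l :: real and c M :: int
  assumes l: "l \<ge> 0" and M: "\<And>x. 0 \<le> x \<Longrightarrow> x \<le> l \<Longrightarrow> \<bar>imbalance n u v e x\<bar> \<le> M"
  shows "l * (\<bar>real_of_int c\<bar> - real_of_int M) \<le> Psi l c (\<lambda>x. imbalance n u v e x)"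
    and "Psi l c (\<lambda>x. imbalance n u v e x) \<le> l * (\<bar>real_of_int c\<bar> + real_of_int M)"
proof -
  define f where "f x = \<bar>real_of_int (imbalance n u v e x) - real_of_int c\<bar>" for x
  have bound: "\<bar>real_of_int c\<bar> - real_of_int M \<le> f x \<and> f x \<le> \<bar>real_of_int c\<bar> + real_of_int M" if "x \<in> {0..l}" for x
  proof -
    have "\<bar>real_of_int (imbalance n u v e x)\<bar> \<le> M" using M[of x] that by auto
    then show ?thesis unfolding f_def by linarith
  qed
  \<comment> \<open>As a function of \<open>x\<close>, each point contributes the indicator of a
    half-line or \<open>0\<close>. So \<open>f\<close> is measurable and, being bounded, integrable;
    the comparison of integrals below relies on that, since \<open>integral\<close> defaults to
    \<open>0\<close>.\<close>
  have "(\<lambda>x. of_bool (p \<in> edge_upto e x) :: real) \<in> borel_measurable borel" for p :: "'a location"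
  proof -
    have "(\<lambda>x. of_bool (p \<in> edge_upto e x) :: real)
        = (if fst p = e \<and> 0 \<le> snd p then indicator {snd p..} else (\<lambda>_. 0))"
      by (cases p) (auto simp: edge_upto_def indicator_def fun_eq_iff)
    then show ?thesis by simp
  qed
  then have "f \<in> borel_measurable borel"
    unfolding f_def imbalance_eq_sum of_int_diff of_int_sum of_int_of_bool
    by (intro borel_measurable_abs borel_measurable_diff borel_measurable_sum) simp_all
  then have "f \<in> borel_measurable (lebesgue_on {0..l})"
    by (intro measurable_restrict_space1 measurable_completion) simp
  then have int: "f integrable_on {0..l}"
    by (rule measurable_bounded_by_integrable_imp_integrable[where g = "\<lambda>_. \<bar>real_of_int c\<bar> + real_of_int M"])
      (use bound in \<open>auto simp: f_def\<close>)
  have Psi: "Psi l c (\<lambda>x. imbalance n u v e x) = integral {0..l} f"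
    by (simp add: Psi_def f_def[abs_def])
  have const: "integral {0..l} (\<lambda>_. k) = l * k" for k :: real
    using l by simp
  show "l * (\<bar>real_of_int c\<bar> - real_of_int M) \<le> Psi l c (\<lambda>x. imbalance n u v e x)"
    unfolding Psi const[symmetric] using bound by (intro integral_le int) auto
  show "Psi l c (\<lambda>x. imbalance n u v e x) \<le> l * (\<bar>real_of_int c\<bar> + real_of_int M)"
    unfolding Psi const[symmetric] using bound by (intro integral_le int) auto
qed

text \<open>The flow from \<open>bounded_flow_exists\<close> costs at most a multiple of
  \<open>M\<close>, while a single edge of positive length already costs at least
  \<open>len G e * (\<bar>c e\<bar> - M)\<close>. The constant depends on the network only and so
  serves all \<open>n\<close> and all samples.\<close>

lemma optimal_flow_bounded:
  assumes G: "is_network G"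
  shows "\<exists>C\<ge>0. \<forall>n u v c M e. (\<forall>i<n. u i \<in> locations G \<and> v i \<in> locations G) \<longrightarrow>
      (\<forall>e\<in>edges G. \<forall>x\<in>{0..len G e}. \<bar>imbalance n u v e x\<bar> \<le> M) \<longrightarrow>
      optimal_flow G n u v c \<longrightarrow> e \<in> edges G \<longrightarrow> len G e > 0 \<longrightarrow> \<bar>real_of_int (c e)\<bar> \<le> C * real_of_int M"
proof -
  obtain K where K: "K \<ge> 0" and flow: "\<forall>s M. (\<Sum>e\<in>edges G. s e) = 0 \<longrightarrow> (\<forall>e\<in>edges G. \<bar>s e\<bar> \<le> M) \<longrightarrow>
           (\<exists>c. (\<forall>a. (\<Sum>e\<in>edges G. incidence G a e * c e) = (\<Sum>e\<in>edges G. inc_plus G a e * s e)) \<and>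
                (\<forall>e\<in>edges G. \<bar>c e\<bar> \<le> K * (M :: int)))"
    using bounded_flow_exists[OF G] by (elim exE conjE)
  have fin: "finite (edges G)" and len: "\<And>e. e \<in> edges G \<Longrightarrow> len G e \<ge> 0"
    using G by (auto simp: is_network_def)
  define L where "L = (\<Sum>e\<in>edges G. len G e)"
  \<comment> \<open>The shortest positive length, capped at \<open>1\<close>, so that
    \<open>Min\<close> is meaningful even if all lengths are \<open>0\<close>.\<close>
  define d where "d = Min (insert 1 {len G e | e. e \<in> edges G \<and> len G e > 0})"
  have fin': "finite (insert 1 {len G e | e. e \<in> edges G \<and> len G e > 0})"
    using fin by simp
  have d: "d > 0" using Min_in[OF fin'] unfolding d_def by auto
  have dle: "d \<le> len G e" if "e \<in> edges G" "len G e > 0" for e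
    unfolding d_def using that fin' by (intro Min_le) auto
  have L: "L \<ge> 0" unfolding L_def by (intro sum_nonneg len)
  show ?thesis
  \<comment> \<open>The summand \<open>1\<close> pays for the \<open>M\<close> in the lower cost
    bound; the quotient comes from the cost bound \<open>L * (K + 1) * M\<close> of the comparison
    flow, divided by a length of at least \<open>d\<close>.\<close>
  proof (intro exI[of _ "1 + L * (real_of_int K + 1) / d"] conjI allI impI)
    show "0 \<le> 1 + L * (real_of_int K + 1) / d" using K L d by simp
  next
    fix n u v c and M :: int and e
    assume loc: "\<forall>i<n. u i \<in> locations G \<and> v i \<in> locations G"
      and M: "\<forall>e\<in>edges G. \<forall>x\<in>{0..len G e}. \<bar>imbalance n u v e x\<bar> \<le> M"
      and opt: "optimal_flow G n u v c" and e: "e \<in> edges G" "len G e > 0"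
    have M0: "M \<ge> 0" using M[rule_format, of e 0] e by auto
    have "(\<Sum>e\<in>edges G. imbalance n u v e (len G e)) = 0"
      using loc by (intro sum_imbalance_eq_0 G) auto
    moreover have "\<forall>e\<in>edges G. \<bar>imbalance n u v e (len G e)\<bar> \<le> M"
      using M len by auto
    ultimately obtain c' where "\<forall>a. (\<Sum>e\<in>edges G. incidence G a e * c' e)
        = (\<Sum>e\<in>edges G. inc_plus G a e * imbalance n u v e (len G e))"
      and c'_le: "\<forall>e\<in>edges G. \<bar>c' e\<bar> \<le> K * M"
      using flow[rule_format, of "\<lambda>e. imbalance n u v e (len G e)" M] by auto
    then have c': "feasible_flow G n u v c'"
      by (simp add: feasible_flow_def)
    have lower: "len G f * (\<bar>real_of_int (c f)\<bar> - real_of_int M) \<le> Psi (len G f) (c f) (\<lambda>x. imbalance n u v f x)" if "f \<in> edges G" for f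
      using Psi_imbalance_bounds(1)[of "len G f" n u v f M "c f"] len[OF that] M that by auto
    have upper: "Psi (len G f) (c' f) (\<lambda>x. imbalance n u v f x) \<le> len G f * ((real_of_int K + 1) * real_of_int M)"
      if f: "f \<in> edges G" for f
    proof -
      have "Psi (len G f) (c' f) (\<lambda>x. imbalance n u v f x) \<le> len G f * (\<bar>real_of_int (c' f)\<bar> + real_of_int M)"
        using Psi_imbalance_bounds(2)[of "len G f" n u v f M "c' f"] len[OF f] M f by auto
      also have "\<dots> \<le> len G f * ((real_of_int K + 1) * real_of_int M)"
      proof (rule mult_left_mono[OF _ len[OF f]])
        have "real_of_int \<bar>c' f\<bar> \<le> real_of_int (K * M)"
          using c'_le f by (intro of_int_le_iff[THEN iffD2]) blast
        then show "\<bar>real_of_int (c' f)\<bar> + real_of_int M \<le> (real_of_int K + 1) * real_of_int M"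
          by (simp add: distrib_right)
      qed
      finally show ?thesis by simp
    qed
    \<comment> \<open>This holds whether or not the integrand is integrable, because
      \<open>integral\<close> is \<open>0\<close> if it is not.\<close>
    have nonneg: "0 \<le> Psi (len G f) (c f) (\<lambda>x. imbalance n u v f x)" for f
      unfolding Psi_def by (cases "(\<lambda>x. \<bar>real_of_int (imbalance n u v f x) - c f\<bar>) integrable_on {0..len G f}")
        (auto intro: integral_nonneg simp: not_integrable_integral)
    have "len G e * (\<bar>real_of_int (c e)\<bar> - real_of_int M) \<le> flow_cost G n u v c"
    proof -
      have "Psi (len G e) (c e) (\<lambda>x. imbalance n u v e x) \<le> flow_cost G n u v c"
        unfolding flow_cost_def by (rule member_le_sum[OF e(1) nonneg fin])
      then show ?thesis using lower[OF e(1)] by simp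
    qed
    also have "\<dots> \<le> flow_cost G n u v c'"
      using opt c' by (auto simp: optimal_flow_def)
    also have "\<dots> \<le> (\<Sum>f\<in>edges G. len G f * ((real_of_int K + 1) * real_of_int M))"
      unfolding flow_cost_def by (intro sum_mono upper)
    also have "\<dots> = L * ((real_of_int K + 1) * real_of_int M)"
      by (simp add: L_def sum_distrib_right)
    finally have "len G e * (\<bar>real_of_int (c e)\<bar> - real_of_int M) \<le> L * ((real_of_int K + 1) * real_of_int M)" .
    then have "\<bar>real_of_int (c e)\<bar> - real_of_int M \<le> L * ((real_of_int K + 1) * real_of_int M) / len G e"
      using e by (simp add: pos_le_divide_eq mult.commute)
    also have "\<dots> \<le> L * ((real_of_int K + 1) * real_of_int M) / d"
      using d dle[OF e] L K M0 by (intro divide_left_mono mult_nonneg_nonneg) auto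
    finally show "\<bar>real_of_int (c e)\<bar> \<le> (1 + L * (real_of_int K + 1) / d) * real_of_int M"
      by (simp add: algebra_simps)
  qed
qed

section \<open>Jumps whose flow leaves the edge\<close>

text \<open>The counts change only at coordinates of sample points. So the left limit at
  \<open>y\<close> is the value at the last such coordinate strictly between \<open>x\<close> and
  \<open>y\<close>, or at \<open>x\<close> if there is none.\<close>

lemma imbalance_before_eq_imbalance:
  assumes xy: "x < y"
  obtains z where "z < y" "z = x \<or> x < z \<and> z \<in> snd ` (u ` {..<n} \<union> v ` {..<n})"
    "imbalance_before n u v e y = imbalance n u v e z"
proof -
  define Q where "Q = snd ` (u ` {..<n} \<union> v ` {..<n})"
  define T where "T = insert x {q \<in> Q. x < q \<and> q < y}"
  define z where "z = Max T"
  have fin: "finite T" by (simp add: T_def Q_def)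
  have zT: "z \<in> T" unfolding z_def using fin by (intro Max_in) (auto simp: T_def)
  then have z: "x \<le> z" "z < y" using xy by (auto simp: T_def)
  have same: "(\<exists>t<y. p \<in> edge_upto e t) \<longleftrightarrow> p \<in> edge_upto e z" if "snd p \<in> Q" for p
  proof
    assume "\<exists>t<y. p \<in> edge_upto e t"
    then have p: "fst p = e" "0 \<le> snd p" "snd p < y" by (auto simp: edge_upto_def)
    have "snd p \<le> z"
    proof (cases "x < snd p")
      case True
      then have "snd p \<in> T" using that p by (auto simp: T_def)
      then show ?thesis unfolding z_def using fin by (rule Max_ge[rotated])
    qed (use z in auto)
    then show "p \<in> edge_upto e z" using p by (cases p) (auto simp: edge_upto_def)
  qed (use z in auto)
  have "imbalance_before n u v e y = imbalance n u v e z"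
    unfolding imbalance_before_def imbalance_def
    by (intro arg_cong2[of _ _ _ _ "(-)"] arg_cong[of _ _ int] arg_cong[of _ _ card] Collect_cong
          conj_cong refl same) (auto simp: Q_def)
  with that[of z] z zT show thesis by (auto simp: T_def Q_def)
qed

text \<open>A discrete intermediate value argument. The witness is the first sample coordinate in
  between with value at most \<open>k\<close>; by minimality the value just before it still exceeds
  \<open>k\<close>.\<close>

lemma imbalance_down_crossing:
  assumes xy: "x < y" and x: "imbalance n u v e x > k" and y: "imbalance_before n u v e y \<le> k"
  shows "\<exists>z. x < z \<and> z < y \<and> imbalance n u v e z \<le> k \<and> k < imbalance_before n u v e z"
proof -
  define Q where "Q = snd ` (u ` {..<n} \<union> v ` {..<n})"
  define T where "T = {t \<in> Q. x < t \<and> t < y \<and> imbalance n u v e t \<le> k}"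
  obtain z where "z < y" "z = x \<or> x < z \<and> z \<in> Q" "imbalance_before n u v e y = imbalance n u v e z"
    using imbalance_before_eq_imbalance[OF xy] unfolding Q_def by metis
  \<comment> \<open>\<open>z = x\<close> is impossible, since the value at \<open>x\<close> exceeds
    \<open>k\<close>. Hence \<open>T\<close> is not empty.\<close>
  then have "z \<in> T" using x y by (auto simp: T_def)
  have fin: "finite T" by (simp add: T_def Q_def)
  define t where "t = Min T"
  have tT: "t \<in> T" unfolding t_def using fin \<open>z \<in> T\<close> by (intro Min_in) auto
  then have t: "x < t" "t < y" "imbalance n u v e t \<le> k" by (auto simp: T_def)
  obtain w where w: "w < t" "w = x \<or> x < w \<and> w \<in> Q" "imbalance_before n u v e t = imbalance n u v e w"
    using imbalance_before_eq_imbalance[OF t(1)] unfolding Q_def by metis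
  have "w \<notin> T" using w(1) fin unfolding t_def by (meson Min_le not_le)
  then have "imbalance n u v e w > k"
    using w t x by (auto simp: T_def)
  then show ?thesis using t w(3) by auto
qed

text \<open>The starting points of the segments \<open>pos_leave\<close> and \<open>neg_leave\<close>: only from these can
  flow reach another edge.\<close>

definition leaving_jumps ::
  "('v, 'e) network \<Rightarrow> nat \<Rightarrow> (nat \<Rightarrow> 'e location) \<Rightarrow> (nat \<Rightarrow> 'e location) \<Rightarrow> ('e \<Rightarrow> int) \<Rightarrow> 'e layer_end set" where
  "leaving_jumps G n u v c = {Jump e x m | e x m. up_jump G n u v c e x m \<and>
     (0 \<le> m \<and> (\<forall>z>x. \<not> down_jump G n u v c e z m) \<or>
      m < 0 \<and> - c e \<le> m \<and> (\<forall>z<x. \<not> up_jump G n u v c e z m))}"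

text \<open>For \<open>m < 0\<close> a leaving jump is the first up-jump of its layer. For
  \<open>m \<ge> 0\<close> the net flow must fall through the layer between two up-jumps, and this
  down-jump would stop the flow of the earlier one.\<close>

lemma leaving_jump_unique:
  assumes "Jump e x m \<in> leaving_jumps G n u v c" "Jump e y m \<in> leaving_jumps G n u v c"
  shows "x = y"
proof -
  have False if xy: "x < y" and x: "Jump e x m \<in> leaving_jumps G n u v c"
    and y: "Jump e y m \<in> leaving_jumps G n u v c" for x y
  proof (cases "m < 0")
    case True
    then show False using x y xy by (auto simp: leaving_jumps_def)
  next
    case False
    have "imbalance n u v e x > m + c e" "imbalance_before n u v e y \<le> m + c e"
      using x y by (auto simp: leaving_jumps_def up_jump_def net_flow_def net_flow_before_def)
    from imbalance_down_crossing[OF xy this] obtain z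
      where z: "x < z" "z < y" "imbalance n u v e z \<le> m + c e" "m + c e < imbalance_before n u v e z"
      by blast
    have "down_jump G n u v c e z m"
      using z x y by (auto simp: leaving_jumps_def up_jump_def down_jump_def net_flow_def net_flow_before_def)
    then show False using x z(1) False by (auto simp: leaving_jumps_def)
  qed
  then show ?thesis using assms by (meson linorder_neqE_linordered_idom)
qed

section \<open>Inter-edge matches counted by leaving jumps\<close>

text \<open>Jumps are never exits, so a nontrivial path starts with a layer segment. Unless the jump
  is a leaving one, this segment ends at a down-jump of the same edge, where no path
  continues.\<close>

lemma flow_path_from_supply:
  assumes path: "flow_path G n u v c \<kappa> (Jump e x m) (Jump e' y m')"
    and up: "up_jump G n u v c e x m" and down: "down_jump G n u v c e' y m'"
  shows "e' = e \<or> Jump e x m \<in> leaving_jumps G n u v c"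
proof -
  let ?R = "\<lambda>p q. layer_segment G n u v c p q \<or> p \<in> exits G n u v c \<and> q = \<kappa> p"
  \<comment> \<open>A segment that starts at a jump starts at an up-jump, and the same jump cannot
    be both up and down.\<close>
  have sink: "\<not> ?R (Jump e y m) q" if "down_jump G n u v c e y m" for e y m q
    using that by (auto simp: exits_def up_jump_def down_jump_def elim: layer_segment.cases)
  from path have "?R\<^sup>*\<^sup>* (Jump e x m) (Jump e' y m')"
    by (simp add: flow_path_def)
  then show ?thesis
  proof (cases rule: converse_rtranclpE)
    case base
    then show ?thesis by simp
  next
    case (step r)
    then have "layer_segment G n u v c (Jump e x m) r" by (auto simp: exits_def)
    then have "Jump e x m \<in> leaving_jumps G n u v c \<or> (\<exists>y. r = Jump e y m \<and> down_jump G n u v c e y m)"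
      by cases (auto simp: leaving_jumps_def)
    moreover have "r = Jump e' y m'" if "r = Jump e y' m" "down_jump G n u v c e y' m" for y'
      using step(2) that sink by (metis (no_types, lifting) converse_rtranclpE)
    ultimately show ?thesis by auto
  qed
qed

text \<open>An edge and a layer determine at most one leaving jump, so it suffices to count layers.
  On an edge of positive length, \<open>m < M + D\<close> and \<open>- D \<le> m\<close>, since
  \<open>0 \<le> m\<close> or \<open>- c e \<le> m\<close>.\<close>

lemma card_leaving_jumps:
  fixes G :: "('v, 'e) network"
  assumes fin: "finite (edges G)" and len: "\<And>e. e \<in> edges G \<Longrightarrow> 0 \<le> len G e"
    and M: "\<forall>e\<in>edges G. \<forall>x\<in>{0..len G e}. \<bar>imbalance n u v e x\<bar> \<le> M"
    and cD: "\<And>e. e \<in> edges G \<Longrightarrow> len G e > 0 \<Longrightarrow> \<bar>c e\<bar> \<le> D" and D: "0 \<le> D" and M0: "0 \<le> M"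
  shows "finite (leaving_jumps G n u v c)"
    and "int (card (leaving_jumps G n u v c)) \<le> int (card (edges G)) * (2 * D + M)"
proof -
  \<comment> \<open>The cost does not see \<open>c e\<close> on an edge of length \<open>0\<close>, where \<open>c e\<close> may be arbitrarily large.
    There all jumps are at \<open>0\<close> and lie in the layers between \<open>- c e\<close> and the net flow.\<close>
  define R where "R e = (if len G e = 0 then {- c e..<- c e + M} else {- D..<D + M})" for e
  \<comment> \<open>Forgetting the coordinate loses nothing on leaving jumps. The values at the
    other constructors are left unspecified, as these are not leaving jumps.\<close>
  define \<phi> :: "'e layer_end \<Rightarrow> 'e \<times> int" where "\<phi> p = (case p of Jump e x m \<Rightarrow> (e, m))" for p
  have inj: "inj_on \<phi> (leaving_jumps G n u v c)"
  proof (rule inj_onI)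
    fix p q assume p: "p \<in> leaving_jumps G n u v c" and q: "q \<in> leaving_jumps G n u v c" and eq: "\<phi> p = \<phi> q"
    obtain e x m where pj: "p = Jump e x m" using p by (auto simp: leaving_jumps_def)
    obtain e' x' m' where qj: "q = Jump e' x' m'" using q by (auto simp: leaving_jumps_def)
    show "p = q" using leaving_jump_unique p q eq unfolding pj qj \<phi>_def by auto
  qed
  have R: "m \<in> R e" if J: "Jump e x m \<in> leaving_jumps G n u v c" for e x m
  proof -
    have e: "e \<in> edges G" "0 \<le> x" "x \<le> len G e" "imbalance_before n u v e x - c e \<le> m"
      "m < imbalance n u v e x - c e" "0 \<le> m \<or> - c e \<le> m"
      using J by (auto simp: leaving_jumps_def up_jump_def net_flow_def net_flow_before_def)
    have b: "\<bar>imbalance n u v e x\<bar> \<le> M" using M e by auto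
    show ?thesis
    proof (cases "len G e = 0")
      case True
      then have "x = 0" using e by auto
      \<comment> \<open>\<open>edge_upto e y\<close> is empty for negative \<open>y\<close>, so the
        left limit at \<open>0\<close> is \<open>0\<close> and the layers start at
        \<open>- c e\<close>.\<close>
      then have none: "(\<exists>y<x. p \<in> edge_upto e y) = False" for p
        by (auto simp: edge_upto_def)
      have "imbalance_before n u v e x = 0"
        unfolding imbalance_before_def none by simp
      then show ?thesis using True e b by (auto simp: R_def)
    next
      case False
      then have "\<bar>c e\<bar> \<le> D" using cD[OF e(1)] len[OF e(1)] by auto
      then show ?thesis using False e b D by (auto simp: R_def)
    qed
  qed
  have sub: "\<phi> ` leaving_jumps G n u v c \<subseteq> Sigma (edges G) R"
  proof (rule image_subsetI)
    fix p assume p: "p \<in> leaving_jumps G n u v c"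
    then obtain e x m where "p = Jump e x m" "e \<in> edges G"
      by (auto simp: leaving_jumps_def up_jump_def)
    then show "\<phi> p \<in> Sigma (edges G) R" using R p by (auto simp: \<phi>_def)
  qed
  have finR: "finite (Sigma (edges G) R)"
    using fin by (intro finite_SigmaI) (auto simp: R_def)
  show "finite (leaving_jumps G n u v c)"
    using inj sub finR by (rule inj_on_finite)
  have "card (leaving_jumps G n u v c) \<le> card (Sigma (edges G) R)"
    using inj sub finR by (rule card_inj_on_le)
  also have "\<dots> = (\<Sum>e\<in>edges G. card (R e))"
    using fin by (intro card_SigmaI) (auto simp: R_def)
  finally have "int (card (leaving_jumps G n u v c)) \<le> (\<Sum>e\<in>edges G. int (card (R e)))"
    by (metis of_nat_mono of_nat_sum)
  also have "\<dots> \<le> (\<Sum>e\<in>edges G. 2 * D + M)"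
    using D M0 by (intro sum_mono) (auto simp: R_def)
  finally show "int (card (leaving_jumps G n u v c)) \<le> int (card (edges G)) * (2 * D + M)"
    by simp
qed

text \<open>A supply point outside the image of \<open>\<alpha>\<close> has its partner at the same
  location. Every other one starts a flow path, and if its partner lies on another edge, it sits at
  a leaving jump.\<close>

lemma card_inter_edge_le:
  assumes match: "matching_of_flow G n u v c \<sigma>"
    and fin: "finite (leaving_jumps G n u v c)"
  shows "card {i. i < n \<and> fst (u i) \<noteq> fst (v (\<sigma> i))} \<le> card (leaving_jumps G n u v c)"
proof -
  obtain \<kappa> \<alpha> \<beta> where
    \<alpha>: "labelling n u (supply_ends G n u v c) \<alpha>" and \<beta>: "labelling n v (demand_ends G n u v c) \<beta>" and
    path: "\<forall>p\<in>supply_ends G n u v c. \<exists>q\<in>demand_ends G n u v c. flow_path G n u v c \<kappa> p q \<and> \<sigma> (\<alpha> p) = \<beta> q" and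
    rest: "\<forall>i<n. i \<notin> \<alpha> ` supply_ends G n u v c \<longrightarrow> v (\<sigma> i) = u i"
    using match unfolding matching_of_flow_def by blast
  have "i \<in> \<alpha> ` leaving_jumps G n u v c" if i: "i < n" "fst (u i) \<noteq> fst (v (\<sigma> i))" for i
  proof -
    have "i \<in> \<alpha> ` supply_ends G n u v c" using rest i by metis
    then obtain p where p: "p \<in> supply_ends G n u v c" "i = \<alpha> p" by blast
    obtain q where q: "q \<in> demand_ends G n u v c" "flow_path G n u v c \<kappa> p q" "\<sigma> i = \<beta> q"
      using path p by blast
    obtain e x m where pj: "p = Jump e x m" "up_jump G n u v c e x m" using p(1) by (auto simp: supply_ends_def)
    obtain e' y m' where qj: "q = Jump e' y m'" "down_jump G n u v c e' y m'"
      using q(1) by (auto simp: demand_ends_def)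
    have "fst (u i) = e" using \<alpha> p pj by (auto simp: labelling_def)
    moreover have "fst (v (\<sigma> i)) = e'" using \<beta> q qj by (auto simp: labelling_def)
    ultimately have "p \<in> leaving_jumps G n u v c"
      using flow_path_from_supply[of G n u v c \<kappa> e x m e' y m'] q pj qj i by auto
    then show ?thesis using p by blast
  qed
  then have "{i. i < n \<and> fst (u i) \<noteq> fst (v (\<sigma> i))} \<subseteq> \<alpha> ` leaving_jumps G n u v c"
    by blast
  then show ?thesis using fin by (meson card_image_le card_mono finite_imageI order_trans)
qed

section \<open>Convergence of the inter-edge fraction\<close>

text \<open>The deterministic half of the argument: randomness enters later, through the bound
  \<open>M\<close> only. The factor \<open>2 * C + 1\<close> comes from \<open>2 * D + M\<close>
  layers per edge with \<open>D\<close> at most \<open>C * M\<close>.\<close>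

lemma inter_edge_matches_bounded:
  assumes G: "is_network G"
  shows "\<exists>C\<ge>0. \<forall>n u v \<sigma> M. (\<forall>i<n. u i \<in> locations G \<and> v i \<in> locations G) \<longrightarrow> 0 \<le> M \<longrightarrow>
      (\<forall>e\<in>edges G. \<forall>x\<in>{0..len G e}. \<bar>imbalance n u v e x\<bar> \<le> M) \<longrightarrow> optimal_matching G n u v \<sigma> \<longrightarrow>
      real (card {i. i < n \<and> fst (u i) \<noteq> fst (v (\<sigma> i))}) \<le> C * real_of_int M"
proof -
  obtain C where C: "C \<ge> 0" and bound: "\<forall>n u v c M e. (\<forall>i<n. u i \<in> locations G \<and> v i \<in> locations G) \<longrightarrow>
      (\<forall>e\<in>edges G. \<forall>x\<in>{0..len G e}. \<bar>imbalance n u v e x\<bar> \<le> M) \<longrightarrow>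
      optimal_flow G n u v c \<longrightarrow> e \<in> edges G \<longrightarrow> len G e > 0 \<longrightarrow> \<bar>real_of_int (c e)\<bar> \<le> C * real_of_int M"
    using optimal_flow_bounded[OF G] by (elim exE conjE)
  have fin: "finite (edges G)" and len: "\<And>e. e \<in> edges G \<Longrightarrow> len G e \<ge> 0"
    using G by (auto simp: is_network_def)
  show ?thesis
  proof (intro exI[of _ "card (edges G) * (2 * C + 1)"] conjI allI impI)
    show "0 \<le> card (edges G) * (2 * C + 1)" using C by simp
  next
    fix n u v \<sigma> and M :: int
    assume loc: "\<forall>i<n. u i \<in> locations G \<and> v i \<in> locations G" and M0: "0 \<le> M"
      and M: "\<forall>e\<in>edges G. \<forall>x\<in>{0..len G e}. \<bar>imbalance n u v e x\<bar> \<le> M"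
      and opt: "optimal_matching G n u v \<sigma>"
    obtain c where c: "optimal_flow G n u v c" and match: "matching_of_flow G n u v c \<sigma>"
      using opt by (auto simp: optimal_matching_def)
    define D where "D = \<lfloor>C * real_of_int M\<rfloor>"
    have cD: "\<bar>c e\<bar> \<le> D" if "e \<in> edges G" "len G e > 0" for e
    proof -
      have "\<bar>real_of_int (c e)\<bar> \<le> C * real_of_int M"
        using bound[THEN spec, THEN spec, THEN spec, THEN spec, THEN spec, THEN spec, THEN mp, OF loc,
            THEN mp, OF M, THEN mp, OF c] that by simp
      then show ?thesis by (simp add: D_def le_floor_iff)
    qed
    have D: "0 \<le> D" using C M0 by (simp add: D_def)
    note leaving = card_leaving_jumps[OF fin len M cD D M0]
    have "card {i. i < n \<and> fst (u i) \<noteq> fst (v (\<sigma> i))} \<le> card (leaving_jumps G n u v c)"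
      by (rule card_inter_edge_le[OF match leaving(1)])
    then have "real (card {i. i < n \<and> fst (u i) \<noteq> fst (v (\<sigma> i))}) \<le> real (card (leaving_jumps G n u v c))"
      by (rule of_nat_mono)
    also have "\<dots> \<le> real_of_int (int (card (edges G)) * (2 * D + M))"
    proof -
      have "real_of_int (int (card (leaving_jumps G n u v c)))
          \<le> real_of_int (int (card (edges G)) * (2 * D + M))"
        by (rule of_int_le_iff[THEN iffD2, OF leaving(2)])
      then show ?thesis by simp
    qed
    also have "\<dots> = card (edges G) * (2 * real_of_int D + real_of_int M)"
      by simp
    also have "\<dots> \<le> card (edges G) * (2 * (C * real_of_int M) + real_of_int M)"
      using of_int_floor_le[of "C * real_of_int M"] by (intro mult_left_mono) (simp_all add: D_def)
    also have "\<dots> = card (edges G) * (2 * C + 1) * real_of_int M"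
      by (simp add: algebra_simps)
    finally show "real (card {i. i < n \<and> fst (u i) \<noteq> fst (v (\<sigma> i))})
        \<le> card (edges G) * (2 * C + 1) * real_of_int M" .
  qed
qed

section \<open>Transfer to random points\<close>

lemma random_points_in_locations:
  assumes "prob_space \<Omega>" "network_measure G \<mu>" "random_points \<Omega> \<mu> \<mu> n U V" "\<omega> \<in> space \<Omega>" "i < n"
  shows "U i \<omega> \<in> locations G \<and> V i \<omega> \<in> locations G"
proof -
  interpret prob_space \<Omega> by fact
  have "case_sum U V k \<in> measurable \<Omega> (case_sum (\<lambda>_. \<mu>) (\<lambda>_. \<mu>) k)" if "k \<in> {..<n} <+> {..<n}" for k
    using assms(3) that unfolding random_points_def indep_vars_def by blast
  from this[of "Inl i"] this[of "Inr i"] assms(5)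
  have "U i \<in> measurable \<Omega> \<mu>" "V i \<in> measurable \<Omega> \<mu>" by auto
  then show ?thesis
    using assms(2,4) by (auto simp: network_measure_def dest: measurable_space)
qed

text \<open>Reading locations as real numbers through \<open>g\<close> turns the imbalance on
  \<open>e\<close> into the difference of two unnormalised empirical distribution functions with the
  same law.\<close>

lemma AE_imbalance_small:
  fixes G :: "('v, 'e) network"
  assumes \<Omega>: "prob_space \<Omega>" and G: "is_network G" and \<mu>: "network_measure G \<mu>"
    and pts: "\<And>n. random_points \<Omega> \<mu> \<mu> n (U n) (V n)"
    and e: "e \<in> edges G" and \<epsilon>: "\<epsilon> > 0"
  shows "AE \<omega> in \<Omega>. \<forall>\<^sub>F n in sequentially. \<forall>x\<in>{0..len G e}.
           \<bar>real_of_int (imbalance n (\<lambda>i. U n i \<omega>) (\<lambda>j. V n j \<omega>) e x)\<bar> \<le> \<epsilon> * real n"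
proof -
  interpret prob_space \<Omega> by (rule \<Omega>)
  interpret \<mu>: prob_space \<mu> using \<mu> by (simp add: network_measure_def)
  have space: "space \<mu> = locations G" using \<mu> by (simp add: network_measure_def)
  have upto: "edge_upto e x \<in> sets \<mu>" if "0 \<le> x" "x \<le> len G e" for x
    using \<mu> e that by (auto simp: network_measure_def)
  have len: "0 \<le> len G e" using G e by (simp add: is_network_def)
  \<comment> \<open>The default beyond \<open>len G e\<close> keeps points on other edges out of
    every count with \<open>x \<le> len G e\<close>.\<close>
  define g where "g p = (if fst p = e then snd p else len G e + 1)" for p :: "'e location"
  have g_le: "{p \<in> space \<mu>. g p \<le> x} = edge_upto e x" if "0 \<le> x" "x \<le> len G e" for x
    using that e unfolding space by (auto simp: g_def locations_def edge_upto_def)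
  have g [measurable]: "g \<in> borel_measurable \<mu>"
  proof (rule borel_measurableI_le)
    fix x :: real
    \<comment> \<open>Measurability is given for the sets \<open>edge_upto e x\<close>. The other
      sublevel sets are empty, equal to the one at \<open>len G e\<close>, or the whole
      space.\<close>
    consider "x < 0" | "0 \<le> x" "x \<le> len G e" | "len G e < x" "x < len G e + 1" | "len G e + 1 \<le> x"
      by linarith
    then show "{p \<in> space \<mu>. g p \<le> x} \<in> sets \<mu>"
    proof cases
      case 1
      then have "{p \<in> space \<mu>. g p \<le> x} = {}"
        using len unfolding space by (auto simp: g_def locations_def edge_upto_def)
      then show ?thesis by (metis sets.empty_sets)
    next
      case 2
      then show ?thesis using upto by (simp add: g_le)
    next
      case 3
      then have "{p \<in> space \<mu>. g p \<le> x} = {p \<in> space \<mu>. g p \<le> len G e}"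
        unfolding space by (auto simp: g_def locations_def edge_upto_def split: if_splits)
      then show ?thesis using upto[of "len G e"] len by (simp add: g_le)
    next
      case 4
      then have "{p \<in> space \<mu>. g p \<le> x} = space \<mu>"
        unfolding space by (auto simp: g_def locations_def edge_upto_def)
      then show ?thesis by simp
    qed
  qed
  define N where "N = distr \<mu> borel g"
  \<comment> \<open>Both samples form one family indexed by a disjoint sum; joint independence
    passes to its \<open>Inl\<close> and \<open>Inr\<close> parts.\<close>
  define W where "W n = case_sum (U n) (V n)" for n
  define X where "X n k \<omega> = g (W n k \<omega>)" for n k \<omega>
  have gN: "g \<in> measurable \<mu> N" by (simp add: N_def)
  have W: "indep_vars (\<lambda>_. \<mu>) (W n) ({..<n} <+> {..<n})" for n
  proof -
    have "case_sum (\<lambda>_. \<mu>) (\<lambda>_. \<mu>) = (\<lambda>_. \<mu>)" by (auto split: sum.split)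
    then show ?thesis using pts[of n] by (simp add: random_points_def W_def)
  qed
  have W_distr: "distr \<Omega> \<mu> (W n k) = \<mu>" if "k \<in> {..<n} <+> {..<n}" for n k
    using pts[of n] that unfolding random_points_def W_def by auto
  have indep: "indep_vars (\<lambda>_. N) (X n) K" if "K \<subseteq> {..<n} <+> {..<n}" for n K
    unfolding X_def by (rule indep_vars_compose2[OF indep_vars_subset[OF W that] gN])
  have X_distr: "distr \<Omega> N (X n k) = N" if k: "k \<in> {..<n} <+> {..<n}" for n k
  proof -
    have "W n k \<in> measurable \<Omega> \<mu>" using W[of n] k by (auto simp: indep_vars_def)
    then have "distr \<Omega> N (X n k) = distr (distr \<Omega> \<mu> (W n k)) N g"
      using gN by (simp add: distr_distr X_def[abs_def] comp_def)
    also have "\<dots> = N" unfolding W_distr[OF k] N_def by (rule distr_cong) simp_all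
    finally show ?thesis .
  qed
  have "real_distribution N"
    unfolding N_def by (rule \<mu>.real_distribution_distr) (rule g)
  then have "AE \<omega> in \<Omega>. \<forall>\<^sub>F n in sequentially. \<forall>x\<in>{0..len G e}.
      \<bar>(\<Sum>k\<in>Inl ` {..<n}. indicator {..x} (X n k \<omega>)) - (\<Sum>k\<in>Inr ` {..<n}. indicator {..x} (X n k \<omega>))\<bar>
        \<le> \<epsilon> * real n"
  proof (rule AE_two_sample_Glivenko_Cantelli[where N = N, rotated 8, OF _ \<epsilon> len])
    fix n
    show "indep_vars (\<lambda>_. N) (X n) (Inl ` {..<n})" "indep_vars (\<lambda>_. N) (X n) (Inr ` {..<n})"
      by (rule indep, blast)+
    show "card (Inl ` {..<n} :: (nat + nat) set) = n" "card (Inr ` {..<n} :: (nat + nat) set) = n"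
      by (simp_all add: card_image)
    show "finite (Inl ` {..<n} :: (nat + nat) set)" "finite (Inr ` {..<n} :: (nat + nat) set)"
      by simp_all
  qed (rule X_distr, blast)+
  then show ?thesis
  proof (rule AE_mp, intro AE_I2 impI)
    fix \<omega> assume \<omega>: "\<omega> \<in> space \<Omega>" and ev: "\<forall>\<^sub>F n in sequentially. \<forall>x\<in>{0..len G e}.
      \<bar>(\<Sum>k\<in>Inl ` {..<n}. indicator {..x} (X n k \<omega>)) - (\<Sum>k\<in>Inr ` {..<n}. indicator {..x} (X n k \<omega>))\<bar>
        \<le> \<epsilon> * real n"
    have eq: "(\<Sum>k\<in>Inl ` {..<n}. indicator {..x} (X n k \<omega>)) - (\<Sum>k\<in>Inr ` {..<n}. indicator {..x} (X n k \<omega>))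
        = real_of_int (imbalance n (\<lambda>i. U n i \<omega>) (\<lambda>j. V n j \<omega>) e x)"
      if x: "x \<in> {0..len G e}" for n x
    proof -
      have "(indicator {..x} (g p) :: real) = of_bool (p \<in> edge_upto e x)" if "p \<in> locations G" for p
        using g_le[of x] x that by (auto simp: space indicator_def)
      then show ?thesis
        using random_points_in_locations[OF \<Omega> \<mu> pts \<omega>, of _ n]
        by (simp add: imbalance_eq_sum sum.reindex X_def W_def)
    qed
    show "\<forall>\<^sub>F n in sequentially. \<forall>x\<in>{0..len G e}.
        \<bar>real_of_int (imbalance n (\<lambda>i. U n i \<omega>) (\<lambda>j. V n j \<omega>) e x)\<bar> \<le> \<epsilon> * real n"
      using ev by eventually_elim (simp add: eq)
  qed
qed

theorem corollary1:
  fixes G :: "('v, 'e) network"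
    and \<Omega> :: "'w measure"
    and \<mu> \<nu> :: "'e location measure"
    and U V :: "nat \<Rightarrow> nat \<Rightarrow> 'w \<Rightarrow> 'e location"
    and \<sigma> :: "nat \<Rightarrow> 'w \<Rightarrow> nat \<Rightarrow> nat"
  assumes "is_network G"
    and "network_measure G \<mu>" and "network_measure G \<nu>" and "sets \<nu> = sets \<mu>"
    and "prob_space \<Omega>"
    and "\<And>n. random_points \<Omega> \<mu> \<nu> n (U n) (V n)"
    and "\<And>n \<omega>. \<omega> \<in> space \<Omega> \<Longrightarrow>
           optimal_matching G n (\<lambda>i. U n i \<omega>) (\<lambda>j. V n j \<omega>) (\<sigma> n \<omega>)"
    and "\<mu> = \<nu>"
  shows "AE \<omega> in \<Omega>.
           (\<lambda>n. inter_edge_fraction n (\<lambda>i. U n i \<omega>) (\<lambda>j. V n j \<omega>) (\<sigma> n \<omega>)) \<longlonglongrightarrow> 0"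
proof -
  note G = assms(1) and \<mu> = assms(2) and \<Omega> = assms(5) and opt = assms(7)
  have pts: "\<And>n. random_points \<Omega> \<mu> \<mu> n (U n) (V n)" using assms(6,8) by simp
  have fin: "finite (edges G)" using G by (simp add: is_network_def)
  obtain C where C: "C \<ge> 0" and bound: "\<forall>n u v \<sigma> M. (\<forall>i<n. u i \<in> locations G \<and> v i \<in> locations G) \<longrightarrow> 0 \<le> M \<longrightarrow>
      (\<forall>e\<in>edges G. \<forall>x\<in>{0..len G e}. \<bar>imbalance n u v e x\<bar> \<le> M) \<longrightarrow> optimal_matching G n u v \<sigma> \<longrightarrow>
      real (card {i. i < n \<and> fst (u i) \<noteq> fst (v (\<sigma> i))}) \<le> C * real_of_int M"
    using inter_edge_matches_bounded[OF G] by (elim exE conjE)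
  \<comment> \<open>Countably many tolerances and finitely many edges leave a single null set.
    Outside it the argument is deterministic and covers any choice of optimal matchings
    \<open>\<sigma> n \<omega>\<close>.\<close>
  have "AE \<omega> in \<Omega>. \<forall>k. \<forall>e\<in>edges G. \<forall>\<^sub>F n in sequentially. \<forall>x\<in>{0..len G e}.
      \<bar>real_of_int (imbalance n (\<lambda>i. U n i \<omega>) (\<lambda>j. V n j \<omega>) e x)\<bar> \<le> 1 / Suc k * real n"
    unfolding AE_all_countable by (intro allI AE_finite_allI fin AE_imbalance_small[OF \<Omega> G \<mu> pts]) auto
  then show ?thesis
  proof (rule AE_mp, intro AE_I2 impI)
    fix \<omega> assume \<omega>: "\<omega> \<in> space \<Omega>"
      and small: "\<forall>k. \<forall>e\<in>edges G. \<forall>\<^sub>F n in sequentially. \<forall>x\<in>{0..len G e}.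
        \<bar>real_of_int (imbalance n (\<lambda>i. U n i \<omega>) (\<lambda>j. V n j \<omega>) e x)\<bar> \<le> 1 / Suc k * real n"
    let ?r = "\<lambda>n. inter_edge_fraction n (\<lambda>i. U n i \<omega>) (\<lambda>j. V n j \<omega>) (\<sigma> n \<omega>)"
    show "?r \<longlonglongrightarrow> 0"
    proof (rule tendstoI)
      fix \<delta> :: real assume \<delta>: "\<delta> > 0"
      \<comment> \<open>\<open>C + 1\<close> in place of \<open>C\<close> allows for
        \<open>C = 0\<close>.\<close>
      then obtain k where k: "inverse (Suc k) < \<delta> / (C + 1)"
        using reals_Archimedean[of "\<delta> / (C + 1)"] C by auto
      have "C * (1 / Suc k) \<le> (C + 1) * inverse (Suc k)" by (simp add: divide_simps)
      also have "\<dots> < \<delta>" using k C by (simp add: field_simps)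
      finally have k\<delta>: "C * (1 / Suc k) < \<delta>" .
      have "\<forall>\<^sub>F n in sequentially. \<forall>e\<in>edges G. \<forall>x\<in>{0..len G e}.
          \<bar>real_of_int (imbalance n (\<lambda>i. U n i \<omega>) (\<lambda>j. V n j \<omega>) e x)\<bar> \<le> 1 / Suc k * real n"
        using small fin by (intro eventually_ball_finite) auto
      with eventually_gt_at_top[of 0] show "\<forall>\<^sub>F n in sequentially. dist (?r n) 0 < \<delta>"
      proof eventually_elim
        case (elim n)
        \<comment> \<open>The imbalance is an integer, so the real bound may be rounded down to the
          integer \<open>M\<close> of the deterministic estimate.\<close>
        define M where "M = \<lfloor>1 / Suc k * real n\<rfloor>"
        have M: "\<bar>imbalance n (\<lambda>i. U n i \<omega>) (\<lambda>j. V n j \<omega>) e x\<bar> \<le> M"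
          if "e \<in> edges G" "x \<in> {0..len G e}" for e x
          using elim(2) that by (simp add: M_def le_floor_iff)
        have loc: "U n i \<omega> \<in> locations G \<and> V n i \<omega> \<in> locations G" if "i < n" for i
          using random_points_in_locations[OF \<Omega> \<mu> pts \<omega> that] .
        have M0: "0 \<le> M" by (simp add: M_def)
        have "real (card {i. i < n \<and> fst (U n i \<omega>) \<noteq> fst (V n (\<sigma> n \<omega> i) \<omega>)}) \<le> C * real_of_int M"
          by (rule bound[rule_format, of n "\<lambda>i. U n i \<omega>" "\<lambda>j. V n j \<omega>", OF loc M0 M opt[OF \<omega>]])
        also have "\<dots> \<le> C * (1 / Suc k * real n)"
          using C by (intro mult_left_mono) (auto simp: M_def)
        finally have "?r n \<le> C * (1 / Suc k)"
          using elim(1) by (simp add: inter_edge_fraction_def pos_divide_le_eq mult_ac)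
        moreover have "0 \<le> ?r n" by (simp add: inter_edge_fraction_def)
        ultimately show ?case using k\<delta> by simp
      qed
    qed
  qed
qed

end
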